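(* For every $n\ge3$, $$|\mathcal{RS}_n(123,213)|=3.$$
   Context: $\mathfrak{S}_n$ is the set of permutations of $\{1,\dots,n\}$, written in one-line notation $\pi=\pi_1\pi_2\dots\pi_n$. A permutation $\pi\in\mathfrak{S}_n$ is simsun if for every $3\le k\le n$, the subword of $\pi_1\pi_2\dots\pi_n$ consisting of the entries in $\{1,\dots,k\}$ (kept in their order) has no double descent, i.e. no three entries that are consecutive in that subword and in decreasing order. A permutation $\pi\in\mathfrak{S}_n$ avoids the pattern $\sigma\in\mathfrak{S}_k$ if there are no indices $i_1<i_2<\dots<i_k$ such that $\pi_{i_1}\pi_{i_2}\dots\pi_{i_k}$ is in the same relative order as $\sigma$. $\mathcal{RS}_n(\sigma,\tau)$ is the set of simsun permutations in $\mathfrak{S}_n$ avoiding both $\sigma$ and $\tau$. *)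

theory Defs
  imports Main "HOL-Combinatorics.Multiset_Permutations"
begin

text \<open>Permutations are written in one-line notation: the elements of the symmetric group
  on \<open>{1..n}\<close> are the lists in \<^term>\<open>permutations_of_set {1..n::nat}\<close>.
  List positions are counted from 0, entries from 1.\<close>

definition has_double_descent :: "nat list \<Rightarrow> bool" where
  "has_double_descent w \<longleftrightarrow>
     (\<exists>i. i + 2 < length w \<and> w ! i > w ! (i + 1) \<and> w ! (i + 1) > w ! (i + 2))"

definition simsun :: "nat \<Rightarrow> nat list \<Rightarrow> bool" where
  "simsun n p \<longleftrightarrow> p \<in> permutations_of_set {1..n} \<and>
     (\<forall>k\<in>{3..n}. \<not> has_double_descent (filter (\<lambda>x. x \<in> {1..k}) p))"

definition contains_pattern :: "nat list \<Rightarrow> nat list \<Rightarrow> bool" where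
  "contains_pattern p s \<longleftrightarrow>
     (\<exists>f. strict_mono_on {..<length s} f \<and> f ` {..<length s} \<subseteq> {..<length p} \<and>
       (\<forall>a<length s. \<forall>b<length s. p ! f a < p ! f b \<longleftrightarrow> s ! a < s ! b))"

abbreviation avoids :: "nat list \<Rightarrow> nat list \<Rightarrow> bool" where
  "avoids p s \<equiv> \<not> contains_pattern p s"

definition RS :: "nat \<Rightarrow> nat list \<Rightarrow> nat list \<Rightarrow> nat list set" where
  "RS n s t = {p. simsun n p \<and> avoids p s \<and> avoids p t}"

end

theory Submission imports Defs begin

text \<open>
  A permutation avoids both 123 and 213 exactly when no entry has two smaller entries to its
  left: two such entries, together with the larger one, would form one of the patterns, according
  to their order. Hence the largest entry occupies one of the first two positions
  (\<open>max_in_first_two_positions\<close>), and deleting it leaves the avoidance condition intact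
  (\<open>two_smaller_before_Cons_max\<close>, \<open>two_smaller_before_Cons_Cons_max\<close>).

  The simsun property of a permutation of \<open>{1..n + 1}\<close> says that it has no double descent itself
  and that deleting \<open>n + 1\<close> leaves a simsun permutation (\<open>simsun_Suc\<close>). So the set for \<open>n + 1\<close>
  arises from the set for \<open>n\<close> by inserting \<open>n + 1\<close> at the front or right after the first entry,
  without creating a double descent. For a permutation \<open>x y z ...\<close> with at least three entries
  exactly one of the two insertions is possible.
  \<^item> If \<open>x < y\<close>, then inserting at the front is harmless. Inserting after \<open>x\<close> would need
    \<open>y < z\<close>, but then \<open>z\<close> would have two smaller entries to its left.
  \<^item> If \<open>x > y\<close>, then inserting at the front creates a double descent. Since \<open>x y z\<close> is
    not a double descent, \<open>y < z\<close>, and so inserting after \<open>x\<close> is harmless.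

  Therefore the cardinality is the same for all \<open>n \<ge> 3\<close>, and for \<open>n = 3\<close> the permutations are
  312, 132 and 231.
\<close>

section \<open>Avoiding 123 and 213\<close>

definition two_smaller_before :: "nat list \<Rightarrow> bool" where
  "two_smaller_before p \<longleftrightarrow>
     (\<exists>i j k. i < j \<and> j < k \<and> k < length p \<and> p ! i < p ! k \<and> p ! j < p ! k)"

lemma contains_pattern_length3:
  "contains_pattern p [a, b, c] \<longleftrightarrow>
     (\<exists>i j k. i < j \<and> j < k \<and> k < length p \<and>
        (\<forall>u<3. \<forall>v<3. p ! ([i, j, k] ! u) < p ! ([i, j, k] ! v) \<longleftrightarrow> [a, b, c] ! u < [a, b, c] ! v))"
    (is "?L \<longleftrightarrow> ?R")
proof
  assume ?L
  then obtain f where f: "strict_mono_on {..<3} f" "f ` {..<3} \<subseteq> {..<length p}"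
    "\<forall>u<3. \<forall>v<3. p ! f u < p ! f v \<longleftrightarrow> [a, b, c] ! u < [a, b, c] ! v"
    unfolding contains_pattern_def by (auto simp: numeral_3_eq_3)
  have "f 0 < f 1" "f 1 < f 2"
    using f(1) by (auto simp: strict_mono_on_def)
  moreover have "f 2 < length p"
    using f(2) by (simp add: image_subset_iff)
  moreover have "[f 0, f 1, f 2] ! u = f u" if "u < 3" for u
    using that by (auto simp: less_Suc_eq numeral_3_eq_3 numeral_2_eq_2)
  ultimately show ?R
    using f(3) by (intro exI[of _ "f 0"] exI[of _ "f 1"] exI[of _ "f 2"]) auto
next
  assume ?R
  then obtain i j k where ijk: "i < j" "j < k" "k < length p"
    "\<forall>u<3. \<forall>v<3. p ! ([i, j, k] ! u) < p ! ([i, j, k] ! v) \<longleftrightarrow> [a, b, c] ! u < [a, b, c] ! v"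
    by blast
  have "strict_mono_on {..<3} ((!) [i, j, k])" "(!) [i, j, k] ` {..<3} \<subseteq> {..<length p}"
    using ijk(1-3) by (auto simp: strict_mono_on_def less_Suc_eq numeral_3_eq_3)
  then show ?L
    unfolding contains_pattern_def using ijk(4)
    by (intro exI[of _ "(!) [i, j, k]"]) (simp add: numeral_3_eq_3)
qed

text \<open>Two smaller entries to the left of a third are distinct, so they form an ascent or a
  descent; the two cases are the two patterns.\<close>

lemma avoids_123_and_213_iff:
  assumes "distinct p"
  shows "avoids p [1, 2, 3] \<and> avoids p [2, 1, 3] \<longleftrightarrow> \<not> two_smaller_before p"
proof -
  have 123: "contains_pattern p [1, 2, 3] \<longleftrightarrow>
      (\<exists>i j k. i < j \<and> j < k \<and> k < length p \<and> p ! i < p ! j \<and> p ! j < p ! k)"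
    unfolding contains_pattern_length3
    by (intro iff_exI) (auto simp: numeral_3_eq_3 All_less_Suc2)
  have 213: "contains_pattern p [2, 1, 3] \<longleftrightarrow>
      (\<exists>i j k. i < j \<and> j < k \<and> k < length p \<and> p ! j < p ! i \<and> p ! i < p ! k)"
    unfolding contains_pattern_length3
    by (intro iff_exI) (auto simp: numeral_3_eq_3 All_less_Suc2)
  have ne: "p ! i < p ! j \<or> p ! j < p ! i" if "i < j" "j < length p" for i j
    using assms that by (metis less_trans nat_neq_iff nth_eq_iff_index_eq)
  have "two_smaller_before p \<longleftrightarrow> contains_pattern p [1, 2, 3] \<or> contains_pattern p [2, 1, 3]"
    unfolding two_smaller_before_def 123 213 using ne by (meson less_trans)
  then show ?thesis by blast
qed

lemma two_smaller_before_Cons: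
  "two_smaller_before (x # p) \<longleftrightarrow>
     two_smaller_before p \<or> (\<exists>j k. j < k \<and> k < length p \<and> x < p ! k \<and> p ! j < p ! k)"
    (is "?L \<longleftrightarrow> ?R")
proof
  assume ?L
  then obtain i j k where "i < j" "j < k" "k < Suc (length p)"
    "(x # p) ! i < (x # p) ! k" "(x # p) ! j < (x # p) ! k"
    unfolding two_smaller_before_def by auto
  then show ?R
    unfolding two_smaller_before_def by (cases i; cases j; cases k) auto
next
  assume ?R
  then show ?L
  proof
    assume "two_smaller_before p"
    then obtain i j k where "i < j" "j < k" "k < length p" "p ! i < p ! k" "p ! j < p ! k"
      unfolding two_smaller_before_def by blast
    then show ?L
      unfolding two_smaller_before_def
      by (intro exI[of _ "Suc i"] exI[of _ "Suc j"] exI[of _ "Suc k"]) auto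
  next
    assume "\<exists>j k. j < k \<and> k < length p \<and> x < p ! k \<and> p ! j < p ! k"
    then obtain j k where "j < k" "k < length p" "x < p ! k" "p ! j < p ! k"
      by blast
    then show ?L
      unfolding two_smaller_before_def
      by (intro exI[of _ 0] exI[of _ "Suc j"] exI[of _ "Suc k"]) auto
  qed
qed

lemma two_smaller_before_Cons_max:
  assumes "\<forall>x\<in>set q. x < m"
  shows "two_smaller_before (m # q) \<longleftrightarrow> two_smaller_before q"
  using assms by (auto simp: two_smaller_before_Cons dest: nth_mem less_asym)

text \<open>In second position the maximum has a single entry to its left, and it is smaller than
  none to its right, so it takes part in no violation.\<close>

lemma two_smaller_before_Cons_Cons_max:
  assumes "\<forall>x\<in>set q. x < m"
  shows "two_smaller_before (a # m # q) \<longleftrightarrow> two_smaller_before (a # q)"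
proof -
  have "(\<exists>j k. j < k \<and> k < length (m # q) \<and> a < (m # q) ! k \<and> (m # q) ! j < (m # q) ! k) \<longleftrightarrow>
      (\<exists>j k. j < k \<and> k < length q \<and> a < q ! k \<and> q ! j < q ! k)" (is "?L \<longleftrightarrow> ?R")
  proof
    assume ?L
    then obtain j k where jk: "j < k" "k < Suc (length q)"
      "a < (m # q) ! k" "(m # q) ! j < (m # q) ! k"
      by auto
    then obtain k' where k': "k = Suc k'" "q ! k' < m"
      using assms by (cases k) auto
    then obtain j' where "j = Suc j'"
      using jk by (cases j) auto
    then show ?R
      using jk k' by auto
  next
    assume ?R
    then obtain j k where "j < k" "k < length q" "a < q ! k" "q ! j < q ! k"
      by blast
    then show ?L
      by (intro exI[of _ "Suc j"] exI[of _ "Suc k"]) auto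
  qed
  then show ?thesis
    by (simp only: two_smaller_before_Cons[of a] two_smaller_before_Cons_max[OF assms])
qed

text \<open>Further to the right, the maximum would have two smaller entries before it.\<close>

lemma max_in_first_two_positions:
  assumes "\<not> two_smaller_before p" "distinct p" "m \<in> set p" "\<forall>x\<in>set p. x \<le> m"
  obtains q where "p = m # q" | a q where "p = a # m # q"
proof -
  obtain k where k: "k < length p" "p ! k = m"
    using assms(3) by (auto simp: in_set_conv_nth)
  have "k < 2"
  proof (rule ccontr)
    assume "\<not> k < 2"
    have "p ! i \<noteq> m" if "i < 2" for i
      using nth_eq_iff_index_eq[OF assms(2), of i k] k that \<open>\<not> k < 2\<close> by auto
    then have "p ! 0 \<noteq> m" "p ! 1 \<noteq> m"
      by simp_all
    moreover have "p ! 0 \<le> m" "p ! 1 \<le> m"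
      using assms(4) k \<open>\<not> k < 2\<close> by (auto intro!: bspec[OF assms(4)] nth_mem)
    ultimately have "two_smaller_before p"
      unfolding two_smaller_before_def using k \<open>\<not> k < 2\<close>
      by (intro exI[of _ 0] exI[of _ 1] exI[of _ k]) auto
    with assms(1) show False by blast
  qed
  then show thesis
  proof (cases "k = 0")
    case True
    then have "p = m # tl p" using k by (cases p) auto
    then show thesis by (rule that)
  next
    case False
    with \<open>k < 2\<close> have "k = 1" by simp
    then have "p = hd p # m # tl (tl p)"
      using k by (cases p; cases "tl p") auto
    then show thesis by (rule that)
  qed
qed

section \<open>Double descents and simsun permutations\<close>

lemma no_double_descent_short: "length w < 3 \<Longrightarrow> \<not> has_double_descent w"
  by (auto simp: has_double_descent_def)

lemma has_double_descent_Cons3: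
  "has_double_descent (x # y # z # w) \<longleftrightarrow> (x > y \<and> y > z) \<or> has_double_descent (y # z # w)"
    (is "?L \<longleftrightarrow> ?R")
proof
  assume ?L
  then obtain i where "i + 2 < length (x # y # z # w)"
    "(x # y # z # w) ! i > (x # y # z # w) ! (i + 1)"
    "(x # y # z # w) ! (i + 1) > (x # y # z # w) ! (i + 2)"
    unfolding has_double_descent_def by blast
  then show ?R
    unfolding has_double_descent_def by (cases i) auto
next
  assume ?R
  then show ?L
  proof
    assume "x > y \<and> y > z"
    then show ?L unfolding has_double_descent_def by (intro exI[of _ 0]) auto
  next
    assume "has_double_descent (y # z # w)"
    then obtain i where "i + 2 < length (y # z # w)"
      "(y # z # w) ! i > (y # z # w) ! (i + 1)"
      "(y # z # w) ! (i + 1) > (y # z # w) ! (i + 2)"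
      unfolding has_double_descent_def by blast
    then show ?L unfolding has_double_descent_def by (intro exI[of _ "Suc i"]) auto
  qed
qed

text \<open>The condition for \<open>k = Suc n\<close> concerns \<open>p\<close> itself; for smaller \<open>k\<close>, restricting
  \<open>p\<close> to \<open>{1..k}\<close> may go through the restriction to \<open>{1..n}\<close>. The bound on \<open>n\<close> puts \<open>Suc n\<close>
  among the values of \<open>k\<close> at which double descents are forbidden.\<close>

lemma simsun_Suc:
  assumes "n \<ge> 2"
  shows "simsun (Suc n) p \<longleftrightarrow> p \<in> permutations_of_set {1..Suc n} \<and>
    \<not> has_double_descent p \<and> simsun n (filter (\<lambda>x. x \<in> {1..n}) p)"
proof (cases "p \<in> permutations_of_set {1..Suc n}")
  case True
  let ?q = "filter (\<lambda>x. x \<in> {1..n}) p"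
  have p: "set p = {1..Suc n}" "distinct p"
    using True by (auto simp: permutations_of_set_def)
  then have q: "?q \<in> permutations_of_set {1..n}"
    by (auto simp: permutations_of_set_def)
  have all: "filter (\<lambda>x. x \<in> {1..Suc n}) p = p"
    using p by (intro filter_True) auto
  have sub: "filter (\<lambda>x. x \<in> {1..k}) p = filter (\<lambda>x. x \<in> {1..k}) ?q" if "k \<in> {3..n}" for k
    using that by (auto intro!: filter_cong)
  have "{3..Suc n} = insert (Suc n) {3..n}"
    using assms by auto
  then have "simsun (Suc n) p \<longleftrightarrow> \<not> has_double_descent p \<and>
      (\<forall>k\<in>{3..n}. \<not> has_double_descent (filter (\<lambda>x. x \<in> {1..k}) p))"
    using True all by (simp only: simsun_def ball_simps(7)) blast
  also have "(\<forall>k\<in>{3..n}. \<not> has_double_descent (filter (\<lambda>x. x \<in> {1..k}) p)) \<longleftrightarrow>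
      (\<forall>k\<in>{3..n}. \<not> has_double_descent (filter (\<lambda>x. x \<in> {1..k}) ?q))"
    using sub by (intro ball_cong refl) (simp only:)
  also have "\<dots> \<longleftrightarrow> simsun n ?q"
    unfolding simsun_def using q by blast
  finally show ?thesis
    using True by blast
next
  case False
  then show ?thesis by (simp add: simsun_def)
qed

lemma mem_RS_iff:
  "p \<in> RS n [1, 2, 3] [2, 1, 3] \<longleftrightarrow> simsun n p \<and> \<not> two_smaller_before p"
  using avoids_123_and_213_iff[of p]
  by (auto simp: RS_def simsun_def permutations_of_set_def)

section \<open>The unique insertion of a new maximum\<close>

text \<open>The position is chosen so that no double descent arises: an initial ascent tolerates the
  new maximum in front, an initial descent requires it in between.\<close>

definition insert_max :: "nat \<Rightarrow> nat list \<Rightarrow> nat list" where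
  "insert_max m p = (if p ! 0 < p ! 1 then m # p else p ! 0 # m # tl p)"

lemma set_insert_max: "p \<noteq> [] \<Longrightarrow> set (insert_max m p) = insert m (set p)"
  by (cases p) (auto simp: insert_max_def)

lemma distinct_insert_max:
  "p \<noteq> [] \<Longrightarrow> distinct p \<Longrightarrow> m \<notin> set p \<Longrightarrow> distinct (insert_max m p)"
  by (cases p) (auto simp: insert_max_def)

lemma filter_insert_max:
  assumes "p \<in> permutations_of_set {1..n}" "p \<noteq> []"
  shows "filter (\<lambda>x. x \<in> {1..n}) (insert_max (Suc n) p) = p"
  using assms by (cases p) (auto simp: insert_max_def permutations_of_set_def intro!: filter_True)

text \<open>With at least three entries, a descent \<open>x > y\<close> at the front of a permutation without double
  descents is followed by an ascent \<open>y < z\<close>; this is what makes the insertion between \<open>x\<close>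
  and \<open>y\<close> safe.\<close>

lemma insert_max_in_RS:
  assumes "n \<ge> 3" "p \<in> RS n [1, 2, 3] [2, 1, 3]"
  shows "insert_max (Suc n) p \<in> RS (Suc n) [1, 2, 3] [2, 1, 3]"
proof -
  have sim: "simsun n p" and good: "\<not> two_smaller_before p"
    using assms(2) unfolding mem_RS_iff by blast+
  have perm: "p \<in> permutations_of_set {1..n}"
    using sim by (simp add: simsun_def)
  then have p: "set p = {1..n}" "distinct p" "length p = n"
    by (auto simp: permutations_of_set_def length_finite_permutations_of_set distinct_card[symmetric])
  \<comment> \<open>The case \<open>k = n\<close> of the simsun condition concerns \<open>p\<close> itself.\<close>
  have nodd: "\<not> has_double_descent p"
  proof -
    have "filter (\<lambda>x. x \<in> {1..n}) p = p" using p by (intro filter_True) auto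
    then show ?thesis using sim assms(1) unfolding simsun_def by force
  qed
  obtain x y z r where xyz: "p = x # y # z # r"
    using p(3) assms(1) by (cases p; cases "tl p"; cases "tl (tl p)") auto
  have less: "\<forall>x\<in>set p. x < Suc n" using p(1) by auto
  let ?p' = "insert_max (Suc n) p"
  have perm': "?p' \<in> permutations_of_set {1..Suc n}"
  proof -
    have "p \<noteq> []" "Suc n \<notin> set p" using xyz p(1) by auto
    then have "set ?p' = insert (Suc n) {1..n}" "distinct ?p'"
      using set_insert_max[of p] distinct_insert_max[of p] p(1,2) by simp_all
    moreover have "insert (Suc n) {1..n} = {1..Suc n}" by auto
    ultimately show ?thesis by (simp only: permutations_of_set_def mem_Collect_eq simp_thms)
  qed
  have nodd': "\<not> has_double_descent ?p'"
    using nodd less p(2) unfolding xyz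
    by (auto simp: insert_max_def has_double_descent_Cons3)
  have "\<not> two_smaller_before ?p'"
    using good less two_smaller_before_Cons_max[of p "Suc n"]
      two_smaller_before_Cons_Cons_max[of "tl p" "Suc n" x]
    unfolding xyz by (auto simp: insert_max_def)
  moreover have "simsun (Suc n) ?p'"
    using simsun_Suc[of n ?p'] perm' nodd' sim filter_insert_max[OF perm] xyz assms(1) by auto
  ultimately show ?thesis unfolding mem_RS_iff by blast
qed

text \<open>Conversely, the position of \<open>n + 1\<close> in \<open>p\<close> is the one that \<open>insert_max\<close> chooses. In front,
  it must be followed by an ascent, as \<open>p\<close> has no double descent. In second position, the same
  reason gives an ascent \<open>y < z\<close> behind it, and then the first entry must exceed \<open>y\<close>.\<close>

lemma RS_Suc_subset:
  assumes "n \<ge> 3" "p \<in> RS (Suc n) [1, 2, 3] [2, 1, 3]"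
  shows "p \<in> insert_max (Suc n) ` RS n [1, 2, 3] [2, 1, 3]"
proof -
  let ?N = "Suc n"
  have sim: "simsun ?N p" and good: "\<not> two_smaller_before p"
    using assms(2) unfolding mem_RS_iff by blast+
  define q where "q = filter (\<lambda>x. x \<in> {1..n}) p"
  have sp: "p \<in> permutations_of_set {1..?N}" "\<not> has_double_descent p" "simsun n q"
    using sim simsun_Suc[of n p] assms(1) by (auto simp: q_def)
  have p: "set p = {1..?N}" "distinct p"
    using sp(1) by (simp_all add: permutations_of_set_def)
  have q: "q \<in> permutations_of_set {1..n}" using sp(3) by (simp add: simsun_def)
  have lenq: "length q = n"
    using q by (simp add: length_finite_permutations_of_set)
  obtain x y z r where xyz: "q = x # y # z # r"
    using lenq assms(1) by (cases q; cases "tl q"; cases "tl (tl q)") auto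
  have less: "\<forall>x\<in>set q. x < ?N" and dist: "distinct q"
    using q by (auto simp: permutations_of_set_def)
  have mem: "?N \<in> set p" and le: "\<forall>x\<in>set p. x \<le> ?N" using p(1) by auto
  have keep: "filter (\<lambda>x. x \<in> {1..n}) s = s" if "set s \<subseteq> set p" "?N \<notin> set s" for s
  proof (rule filter_True, rule ballI)
    fix x assume "x \<in> set s"
    then have "x \<in> {1..?N}" "x \<noteq> ?N" using that p(1) by blast+
    then show "x \<in> {1..n}" by auto
  qed
  have "p = insert_max ?N q \<and> \<not> two_smaller_before q"
  proof (rule max_in_first_two_positions[OF good p(2) mem le])
    fix s assume s: "p = ?N # s"
    have "filter (\<lambda>x. x \<in> {1..n}) s = s"
      using p(2) s by (intro keep) auto
    then have "s = q"
      unfolding q_def s by simp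
    then show ?thesis
      using s sp(2) good less dist two_smaller_before_Cons_max[of q ?N] xyz
      by (auto simp: insert_max_def has_double_descent_Cons3)
  next
    fix a s assume s: "p = a # ?N # s"
    have "filter (\<lambda>x. x \<in> {1..n}) (a # s) = a # s"
      using p(2) s by (intro keep) auto
    moreover have "filter (\<lambda>x. x \<in> {1..n}) p = filter (\<lambda>x. x \<in> {1..n}) (a # s)"
      unfolding s by simp
    ultimately have q_eq: "a # s = q"
      unfolding q_def by simp
    then have as: "a = x" "s = y # z # r" using xyz by auto
    have good': "\<not> two_smaller_before q"
      using good less two_smaller_before_Cons_Cons_max[of s ?N a] s q_eq by auto
    have "y < z"
      using sp(2) less dist unfolding s as xyz by (auto simp: has_double_descent_Cons3)
    have "\<not> x < y"
    proof
      assume "x < y"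
      then have "two_smaller_before q"
        unfolding two_smaller_before_def xyz using \<open>y < z\<close>
        by (intro exI[of _ 0] exI[of _ 1] exI[of _ 2]) auto
      with good' show False by blast
    qed
    then show ?thesis
      using s as xyz good' by (auto simp: insert_max_def)
  qed
  then have "p = insert_max ?N q" "q \<in> RS n [1, 2, 3] [2, 1, 3]"
    using sp(3) unfolding mem_RS_iff by blast+
  then show ?thesis by (rule image_eqI)
qed

text \<open>Insertion is injective because the original permutation is recovered by deleting the
  new maximum.\<close>

lemma card_RS_Suc:
  assumes "n \<ge> 3"
  shows "card (RS (Suc n) [1, 2, 3] [2, 1, 3]) = card (RS n [1, 2, 3] [2, 1, 3])"
proof -
  have "RS (Suc n) [1, 2, 3] [2, 1, 3] = insert_max (Suc n) ` RS n [1, 2, 3] [2, 1, 3]"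
    using RS_Suc_subset[OF assms] insert_max_in_RS[OF assms] by blast
  moreover have "inj_on (insert_max (Suc n)) (RS n [1, 2, 3] [2, 1, 3])"
  proof (rule inj_on_inverseI)
    fix p assume "p \<in> RS n [1, 2, 3] [2, 1, 3]"
    then have "p \<in> permutations_of_set {1..n}"
      unfolding mem_RS_iff simsun_def by blast
    moreover from this have "p \<noteq> []" using assms by (auto simp: permutations_of_set_def)
    ultimately show "filter (\<lambda>x. x \<in> {1..n}) (insert_max (Suc n) p) = p"
      by (rule filter_insert_max)
  qed
  ultimately show ?thesis by (simp only: card_image)
qed

lemma RS_3: "RS 3 [1, 2, 3] [2, 1, 3] = {[3, 1, 2], [1, 3, 2], [2, 3, 1]}"
proof -
  have set3: "{1..3::nat} = {1, 2, 3}" by auto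
  have tsb: "two_smaller_before [a, b, c] \<longleftrightarrow> a < c \<and> b < c" for a b c
    by (auto simp: two_smaller_before_Cons less_Suc_eq) (simp_all add: two_smaller_before_def)
  have dd: "has_double_descent [a, b, c] \<longleftrightarrow> a > b \<and> b > c" for a b c
    by (simp add: has_double_descent_Cons3 no_double_descent_short)
  have mem: "p \<in> RS 3 [1, 2, 3] [2, 1, 3] \<longleftrightarrow> p \<in> permutations_of_set {1, 2, 3} \<and>
      \<not> has_double_descent p \<and> \<not> two_smaller_before p" for p
  proof -
    have "filter (\<lambda>x. x \<in> {1..3}) p = p" if "p \<in> permutations_of_set {1, 2, 3}"
      using that by (intro filter_True) (auto simp: permutations_of_set_def)
    then show ?thesis unfolding mem_RS_iff simsun_def set3[symmetric] by auto
  qed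
  have shape: "\<exists>a b c. p = [a, b, c]" if "p \<in> permutations_of_set {1, 2, 3::nat}" for p
  proof -
    have "length p = 3" using that by (simp add: length_finite_permutations_of_set)
    then show ?thesis by (auto simp: numeral_3_eq_3 length_Suc_conv)
  qed
  show ?thesis
  proof (intro set_eqI iffI)
    fix p assume "p \<in> RS 3 [1, 2, 3] [2, 1, 3]"
    then have p: "p \<in> permutations_of_set {1, 2, 3}" "\<not> has_double_descent p"
      "\<not> two_smaller_before p"
      unfolding mem by blast+
    from shape[OF p(1)] obtain a b c where abc: "p = [a, b, c]" by (elim exE)
    have "set p = {1, 2, 3}" "distinct p"
      using p(1) by (simp_all only: permutations_of_set_def mem_Collect_eq)
    moreover have "a \<in> set p" "b \<in> set p" "c \<in> set p"
      unfolding abc by simp_all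
    ultimately have "a \<in> {1, 2, 3}" "b \<in> {1, 2, 3}" "c \<in> {1, 2, 3}"
      "a \<noteq> b" "a \<noteq> c" "b \<noteq> c"
      by (simp_all only: abc distinct.simps list.set) simp_all
    then show "p \<in> {[3, 1, 2], [1, 3, 2], [2, 3, 1]}"
      using p(2,3) unfolding abc tsb dd by auto
  next
    fix p :: "nat list" assume "p \<in> {[3, 1, 2], [1, 3, 2], [2, 3, 1]}"
    then show "p \<in> RS 3 [1, 2, 3] [2, 1, 3]"
      unfolding mem by (auto simp: tsb dd permutations_of_set_def)
  qed
qed

theorem lemma7p2:
  fixes n :: nat
  assumes "n \<ge> 3"
  shows "card (RS n [1, 2, 3] [2, 1, 3]) = 3"
  using assms
proof (induction n rule: dec_induct)
  case base
  show ?case unfolding RS_3 by simp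
next
  case (step m)
  then show ?case using card_RS_Suc[of m] by simp
qed

end
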